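(* Suppose a subspace $W\subset\mathbb{R}^n$ and $\mu>0$ satisfy $$w^\top\nabla^2f(z)w\le-\mu\|w\|^2\qquad(w\in W,\ z\in\widehat X).$$ Let $V=W^\perp$ and $R=\sup_{z\in\widehat X}\|\nabla^2f(z)\|_{\mathrm{op}}<\infty$. Then $$\Bigl(R+\frac{R^2}{\mu}\Bigr)P_V\in\mathcal{B}(f;X),\qquad d^\star(f;X)\le n-\dim W.$$
   Context: $X\subset\mathbb{R}^n$ is compact and full dimensional (its affine hull is $\mathbb{R}^n$), $\widehat X=\operatorname{conv}X$, and $f$ is a real-valued $C^2$ function on an open neighborhood of $\widehat X$. $\|\cdot\|$ is the Euclidean norm, $\|\cdot\|_{\mathrm{op}}$ the spectral norm, $P_V$ the Euclidean orthogonal projection onto $V$, and $\succeq$ the Loewner order. $\mathcal{D}^2(f;X)$ is the set of pairs $(g,h)$ of functions that are $C^2$ on a neighborhood of $\widehat X$, satisfy $f=g-h$ there, and are convex on $\widehat X$ (equivalently, have positive semidefinite Hessians at every point of $\widehat X$). For a $C^2$ convex $g$: $V_X(g)=\operatorname{span}\bigl(\bigcup_{z\in\widehat X}\operatorname{range}\nabla^2g(z)\bigr)$, $d_X(g)=\dim V_X(g)$, and $d^\star(f;X)=\min_{(g,h)\in\mathcal{D}^2(f;X)}d_X(g)$. $\mathcal{B}(f;X)=\{B\in\mathbb{R}^{n\times n}\text{ symmetric positive semidefinite}: B-\nabla^2f(z)\succeq0\text{ for every }z\in\widehat X\}$. *)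

theory Defs
  imports "HOL-Analysis.Analysis"
begin

definition gradient :: "(real^'n \<Rightarrow> real) \<Rightarrow> real^'n \<Rightarrow> real^'n" where
  "gradient f x = (\<chi> i. frechet_derivative f (at x) (axis i 1))"

definition hessian :: "(real^'n \<Rightarrow> real) \<Rightarrow> real^'n \<Rightarrow> real^'n^'n" where
  "hessian f x = jacobian (gradient f) (at x)"

text \<open>Functions are total; only their values on the open set \<open>U\<close> matter here.\<close>

definition C2_on :: "(real^'n \<Rightarrow> real) \<Rightarrow> (real^'n) set \<Rightarrow> bool" where
  "C2_on f U \<longleftrightarrow> open U \<and>
     (\<forall>x\<in>U. f differentiable (at x)) \<and>
     (\<forall>x\<in>U. gradient f differentiable (at x)) \<and>
     continuous_on U (hessian f)"

definition psd :: "real^'n^'n \<Rightarrow> bool" where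
  "psd A \<longleftrightarrow> transpose A = A \<and> (\<forall>v. 0 \<le> v \<bullet> (A *v v))"

definition loewner_le :: "real^'n^'n \<Rightarrow> real^'n^'n \<Rightarrow> bool" where
  "loewner_le A B \<longleftrightarrow> psd (B - A)"

definition spectral_norm :: "real^'n^'n \<Rightarrow> real" where
  "spectral_norm A = onorm (\<lambda>v. A *v v)"

definition orth_proj :: "(real^'n) set \<Rightarrow> real^'n^'n" where
  "orth_proj V = matrix (\<lambda>x. THE p. p \<in> V \<and> x - p \<in> V\<^sup>\<bottom>)"

definition D2 :: "(real^'n \<Rightarrow> real) \<Rightarrow> (real^'n) set \<Rightarrow>
    ((real^'n \<Rightarrow> real) \<times> (real^'n \<Rightarrow> real)) set" where
  "D2 f X = {(g, h).
     (\<exists>U. open U \<and> convex hull X \<subseteq> U \<and> C2_on g U \<and> C2_on h U \<and> (\<forall>x\<in>U. f x = g x - h x)) \<and>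
     convex_on (convex hull X) g \<and> convex_on (convex hull X) h}"

definition curv_space :: "(real^'n) set \<Rightarrow> (real^'n \<Rightarrow> real) \<Rightarrow> (real^'n) set" where
  "curv_space X g = span (\<Union>z\<in>convex hull X. range (\<lambda>v. hessian g z *v v))"

definition curv_dim :: "(real^'n) set \<Rightarrow> (real^'n \<Rightarrow> real) \<Rightarrow> nat" where
  "curv_dim X g = dim (curv_space X g)"

text \<open>The infimum is taken in \<^typ>\<open>enat\<close>, so that it is \<open>\<infinity>\<close> if there is no decomposition; over a
  nonempty set it is attained (lemma \<open>d_star_attained\<close> below), hence a minimum.  A finite upper
  bound on \<open>d_star f X\<close> therefore includes the existence of a decomposition.\<close>

definition d_star :: "(real^'n \<Rightarrow> real) \<Rightarrow> (real^'n) set \<Rightarrow> enat" where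
  "d_star f X = (INF (g, h)\<in>D2 f X. enat (curv_dim X g))"

definition hess_majorants :: "(real^'n \<Rightarrow> real) \<Rightarrow> (real^'n) set \<Rightarrow> (real^'n^'n) set" where
  "hess_majorants f X = {B. psd B \<and> (\<forall>z\<in>convex hull X. loewner_le (hessian f z) B)}"

lemma d_star_attained:
  assumes "D2 f X \<noteq> {}"
  shows "\<exists>(g, h)\<in>D2 f X. d_star f X = enat (curv_dim X g)"
proof -
  let ?S = "(\<lambda>(g, h). enat (curv_dim X g)) ` D2 f X"
  have "?S \<noteq> {}" using assms by simp
  then have "Inf ?S \<in> ?S"
    unfolding Inf_enat_def by (metis (no_types, lifting) LeastI ex_in_conv)
  then show ?thesis
    unfolding d_star_def by auto
qed

lemma orth_proj_works:
  fixes V :: "(real^'n) set"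
  assumes V: "subspace V"
  shows "orth_proj V *v x \<in> V" "x - orth_proj V *v x \<in> V\<^sup>\<bottom>"
proof -
  let ?P = "\<lambda>x p. p \<in> V \<and> x - p \<in> V\<^sup>\<bottom>"
  let ?p = "\<lambda>x. THE p. ?P x p"
  have uniq: "p = q" if "?P x p" "?P x q" for x p q
  proof -
    have "p - q \<in> V" using that V by (auto intro: subspace_diff)
    moreover have "p - q \<in> V\<^sup>\<bottom>"
      using subspace_diff[OF subspace_orthogonal_comp, of "x - q" V "x - p"] that by simp
    ultimately have "orthogonal (p - q) (p - q)" by (auto simp: orthogonal_comp_def)
    then show ?thesis by (simp add: orthogonal_def)
  qed
  have ex: "\<exists>p. ?P x p" for x
  proof -
    obtain y z where yz: "y \<in> span V" "\<And>w. w \<in> span V \<Longrightarrow> orthogonal z w" "x = y + z"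
      using orthogonal_subspace_decomp_exists by blast
    have sV: "span V = V" using V by simp
    have "?P x y"
      using yz(1,2)[unfolded sV] yz(3) by (simp add: orthogonal_comp_def orthogonal_commute)
    then show ?thesis by blast
  qed
  have P: "?P x (?p x)" for x
  proof -
    obtain q where "?P x q" using ex by blast
    then show ?thesis by (rule theI) (rule uniq[OF _ \<open>?P x q\<close>])
  qed
  have eqI: "?p x = q" if "?P x q" for x q
    by (rule uniq[OF P that])
  have "linear ?p"
  proof (rule linearI)
    fix x y :: "real^'n" and c :: real
    have "x + y - (?p x + ?p y) \<in> V\<^sup>\<bottom>"
      using subspace_add[OF subspace_orthogonal_comp, of "x - ?p x" V "y - ?p y"] P[of x] P[of y]
      by (simp add: algebra_simps)
    then show "?p (x + y) = ?p x + ?p y"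
      using P[of x] P[of y] V by (intro eqI conjI subspace_add) simp_all
    have "c *\<^sub>R x - c *\<^sub>R ?p x \<in> V\<^sup>\<bottom>"
      using subspace_scale[OF subspace_orthogonal_comp, of "x - ?p x" V c] P[of x]
      by (simp add: algebra_simps)
    then show "?p (c *\<^sub>R x) = c *\<^sub>R ?p x"
      using P[of x] V by (intro eqI conjI subspace_scale) simp_all
  qed
  then have "orth_proj V *v x = ?p x"
    by (simp add: orth_proj_def matrix_works linear_matrix_vector_mul_eq)
  then show "orth_proj V *v x \<in> V" "x - orth_proj V *v x \<in> V\<^sup>\<bottom>"
    using P[of x] by simp_all
qed

end

theory Submission
  imports Defs
begin

text \<open>For \<open>v = w + p\<close> with \<open>w \<in> W\<close>, \<open>p \<in> V\<close>, symmetry of the Hessian \<open>H\<close> and the bounds on it give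
  \<open>v \<bullet> H v \<le> - \<mu> |w|\<^sup>2 + 2 R |w| |p| + R |p|\<^sup>2 \<le> (R + R\<^sup>2 / \<mu>) |p|\<^sup>2\<close> by completing the square, so \<open>c P\<^sub>V\<close> with
  \<open>c = R + R\<^sup>2 / \<mu>\<close> dominates every Hessian.  The decomposition \<open>f = g - (g - f)\<close> with
  \<open>g x = (c / 2) (x \<bullet> P\<^sub>V x)\<close> then has a curvature space contained in \<open>V\<close>.\<close>

section \<open>Gradients and Hessians\<close>

text \<open>\<open>gradient\<close> records the derivative on the standard basis only; linearity
  recovers it on every \<open>v\<close>.\<close>

lemma has_derivative_gradient:
  fixes f :: "real^'n \<Rightarrow> real"
  assumes "f differentiable (at x)"
  shows "(f has_derivative (\<lambda>v. gradient f x \<bullet> v)) (at x)"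
proof -
  let ?D = "frechet_derivative f (at x)"
  have D: "(f has_derivative ?D) (at x)"
    using assms by (simp add: frechet_derivative_works)
  then have lin: "linear ?D"
    by (rule has_derivative_linear)
  have "?D v = gradient f x \<bullet> v" for v
  proof -
    have "?D v = ?D (\<Sum>i\<in>UNIV. v $ i *\<^sub>R axis i 1)"
      using basis_expansion[of v] by (simp add: scalar_mult_eq_scaleR)
    also have "\<dots> = (\<Sum>i\<in>UNIV. v $ i * ?D (axis i 1))"
      by (simp add: linear_sum[OF lin] linear_scale[OF lin])
    also have "\<dots> = gradient f x \<bullet> v"
      by (simp add: gradient_def inner_vec_def mult.commute)
    finally show ?thesis .
  qed
  then have "?D = (\<lambda>v. gradient f x \<bullet> v)" by blast
  with D show ?thesis by simp
qed

lemma gradient_eqI: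
  fixes f :: "real^'n \<Rightarrow> real"
  assumes "(f has_derivative (\<lambda>v. a \<bullet> v)) (at x)"
  shows "gradient f x = a"
  unfolding gradient_def frechet_derivative_at[OF assms, symmetric]
  by (simp add: vec_eq_iff inner_axis)

lemma has_derivative_hessian:
  assumes "gradient f differentiable (at x)"
  shows "(gradient f has_derivative (\<lambda>v. hessian f x *v v)) (at x)"
  using assms unfolding hessian_def jacobian_works .

lemma hessian_eqI:
  assumes "(gradient f has_derivative (\<lambda>v. A *v v)) (at x)"
  shows "hessian f x = A"
  using frechet_derivative_at[OF assms, symmetric] by (simp add: hessian_def jacobian_def)

lemma C2_onD:
  assumes "C2_on f U" "x \<in> U"
  shows "(f has_derivative (\<lambda>v. gradient f x \<bullet> v)) (at x)"
    and "(gradient f has_derivative (\<lambda>v. hessian f x *v v)) (at x)"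
  using assms by (simp_all add: C2_on_def has_derivative_gradient has_derivative_hessian)

lemma
  assumes f: "C2_on f U" and g: "C2_on g U"
  shows C2_on_diff: "C2_on (\<lambda>x. f x - g x) U"
    and hessian_diff: "\<And>x. x \<in> U \<Longrightarrow> hessian (\<lambda>x. f x - g x) x = hessian f x - hessian g x"
proof -
  let ?h = "\<lambda>x. f x - g x"
  have U: "open U" using f by (simp add: C2_on_def)
  have dh: "(?h has_derivative (\<lambda>v. (gradient f x - gradient g x) \<bullet> v)) (at x)" if "x \<in> U" for x
    using has_derivative_diff[OF C2_onD(1)[OF f that] C2_onD(1)[OF g that]]
    by (simp add: inner_diff_left)
  have gh: "gradient f x - gradient g x = gradient ?h x" if "x \<in> U" for x
    using gradient_eqI[OF dh[OF that]] by simp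
  have ddh: "(gradient ?h has_derivative (\<lambda>v. (hessian f x - hessian g x) *v v)) (at x)"
    if "x \<in> U" for x
  \<comment> \<open>The formula for the gradient of the difference is known only on
    \<open>U\<close>. Since \<open>U\<close> is open, it holds near \<open>x\<close>, which suffices
    to differentiate it once more.\<close>
  proof (rule has_derivative_transform_within_open[OF _ U that gh])
    show "((\<lambda>y. gradient f y - gradient g y) has_derivative
        (\<lambda>v. (hessian f x - hessian g x) *v v)) (at x)"
      using has_derivative_diff[OF C2_onD(2)[OF f that] C2_onD(2)[OF g that]]
      by (simp add: matrix_vector_mult_diff_rdistrib)
  qed
  show hh: "hessian ?h x = hessian f x - hessian g x" if "x \<in> U" for x
    using ddh[OF that] by (rule hessian_eqI)
  have "continuous_on U (\<lambda>x. hessian f x - hessian g x)"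
    using f g by (intro continuous_on_diff) (simp_all add: C2_on_def)
  then have "continuous_on U (hessian ?h)"
    by (rule continuous_on_eq) (simp add: hh)
  with U dh ddh show "C2_on ?h U"
    unfolding C2_on_def differentiable_def by blast
qed

lemma C2_on_subset: "C2_on f U \<Longrightarrow> open S \<Longrightarrow> S \<subseteq> U \<Longrightarrow> C2_on f S"
  unfolding C2_on_def by (blast intro: continuous_on_subset)

lemma transpose_eq_self_iff:
  fixes A :: "real^'n^'n"
  shows "transpose A = A \<longleftrightarrow> (\<forall>u v. u \<bullet> (A *v v) = v \<bullet> (A *v u))"
proof -
  have *: "u \<bullet> (transpose A *v v) = v \<bullet> (A *v u)" for u v
    by (metis dot_lmul_matrix inner_commute vector_transpose_matrix)
  show ?thesis
    by (metis * matrix_eq vector_eq_ldot)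
qed

text \<open>The factor 1/2 makes the Hessian exactly \<open>A\<close>: by symmetry the two terms of
  the product rule agree, so the gradient at \<open>x\<close> is \<open>A *v x\<close>.\<close>

lemma
  fixes A :: "real^'n^'n"
  assumes A: "transpose A = A"
  defines "q \<equiv> \<lambda>x. (1/2) * (x \<bullet> (A *v x))"
  shows C2_on_quadratic: "C2_on q UNIV"
    and hessian_quadratic: "hessian q = (\<lambda>x. A)"
proof -
  have dq: "(q has_derivative (\<lambda>v. (A *v x) \<bullet> v)) (at x)" for x
  proof -
    have "((\<lambda>v. A *v v) has_derivative (\<lambda>v. A *v v)) (at x)"
      by (simp add: bounded_linear_imp_has_derivative)
    from has_derivative_mult_right[OF has_derivative_inner[OF has_derivative_ident this], of "1/2"]
    have "(q has_derivative (\<lambda>v. (1/2) * (x \<bullet> (A *v v) + v \<bullet> (A *v x)))) (at x)"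
      by (simp only: q_def)
    moreover have "x \<bullet> (A *v v) = (A *v x) \<bullet> v" "v \<bullet> (A *v x) = (A *v x) \<bullet> v" for v
      using A[unfolded transpose_eq_self_iff] by (simp_all add: inner_commute)
    ultimately show ?thesis by simp
  qed
  then have gq: "gradient q = (\<lambda>x. A *v x)"
    by (intro ext gradient_eqI)
  have ddq: "(gradient q has_derivative (\<lambda>v. A *v v)) (at x)" for x
    unfolding gq by (simp add: bounded_linear_imp_has_derivative)
  then show hq: "hessian q = (\<lambda>x. A)"
    by (intro ext hessian_eqI)
  show "C2_on q UNIV"
    unfolding C2_on_def hq using dq ddq by (auto simp: differentiable_def)
qed

section \<open>Symmetry of the Hessian\<close>

text \<open>The second difference is symmetric in \<open>u\<close> and \<open>v\<close>, while its quadratic approximation is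
  \<open>t\<^sup>2 (v \<bullet> H u)\<close>; this needs differentiability of the gradient only at the point itself.\<close>

lemma second_difference_approx:
  fixes f :: "real^'n \<Rightarrow> real"
  assumes U: "open U" "z \<in> U" and df: "\<forall>x\<in>U. f differentiable (at x)"
    and ddf: "gradient f differentiable (at z)" and "e > 0"
  shows "eventually (\<lambda>t. \<bar>f (z + t *\<^sub>R u + t *\<^sub>R v) - f (z + t *\<^sub>R u) - f (z + t *\<^sub>R v) + f z
            - t\<^sup>2 * (v \<bullet> (hessian f z *v u))\<bar> \<le> e * t\<^sup>2) (at_right 0)"
proof -
  define H where "H = hessian f z"
  \<comment> \<open>\<open>t * C\<close> bounds every displacement
    \<open>a *\<^sub>R u + s *\<^sub>R v\<close> with \<open>a\<close> and \<open>s\<close> in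
    [0, t]. The summand 1 keeps \<open>C\<close> positive when \<open>u = v = 0\<close>.\<close>
  define C where "C = norm u + norm v + 1"
  have C: "C > 0" "norm v \<le> C" "norm u + norm v \<le> C" by (simp_all add: C_def add_nonneg_pos)
  \<comment> \<open>Chosen so that the final error
    \<open>t * ((2 * \<epsilon> * (t * C)) * C)\<close> is \<open>e * t\<^sup>2\<close>.\<close>
  define \<epsilon> where "\<epsilon> = e / (2 * C * C)"
  have \<epsilon>: "\<epsilon> > 0" using \<open>e > 0\<close> C by (simp add: \<epsilon>_def)
  obtain r where r: "r > 0" "ball z r \<subseteq> U" using U open_contains_ball by blast
  obtain d where d: "d > 0" and
    dH: "\<And>y. norm (y - z) < d \<Longrightarrow>
      norm (gradient f y - gradient f z - H *v (y - z)) \<le> \<epsilon> * norm (y - z)"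
    using has_derivative_hessian[OF ddf] \<epsilon> unfolding has_derivative_at_alt H_def by blast
  define \<delta> where "\<delta> = min r d / C"
  have \<delta>: "\<delta> > 0" using r d C by (simp add: \<delta>_def)
  have "\<bar>f (z + t *\<^sub>R u + t *\<^sub>R v) - f (z + t *\<^sub>R u) - f (z + t *\<^sub>R v) + f z
            - t\<^sup>2 * (v \<bullet> (H *v u))\<bar> \<le> e * t\<^sup>2" if t: "0 < t" "t < \<delta>" for t
  proof -
    have tC: "t * C < r" "t * C < d"
      using t C by (simp_all add: \<delta>_def field_simps)
    have small: "norm (a *\<^sub>R u + s *\<^sub>R v) \<le> t * C" if "0 \<le> a" "a \<le> t" "0 \<le> s" "s \<le> t" for a s
    proof -
      have "norm (a *\<^sub>R u + s *\<^sub>R v) \<le> a * norm u + s * norm v"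
        using norm_triangle_ineq[of "a *\<^sub>R u" "s *\<^sub>R v"] that by simp
      also have "\<dots> \<le> t * norm u + t * norm v"
        using that by (intro add_mono mult_right_mono) auto
      also have "\<dots> = t * (norm u + norm v)" by (simp add: algebra_simps)
      also have "\<dots> \<le> t * C"
        using t C by (intro mult_left_mono) auto
      finally show ?thesis .
    qed
    have inU: "z + (a *\<^sub>R u + s *\<^sub>R v) \<in> U" if "0 \<le> a" "a \<le> t" "0 \<le> s" "s \<le> t" for a s
    proof -
      have "dist (z + (a *\<^sub>R u + s *\<^sub>R v)) z < r"
        using small[OF that] tC unfolding dist_norm by simp
      then show ?thesis using r(2) by (auto simp: dist_commute)
    qed
    define F where "F a s = f (z + (a *\<^sub>R u + s *\<^sub>R v))" for a s
    define G where "G a s = gradient f (z + (a *\<^sub>R u + s *\<^sub>R v))" for a s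
    have dF: "((\<lambda>s. F a s) has_derivative (\<lambda>h. G a s \<bullet> (h *\<^sub>R v))) (at s)"
      if "0 \<le> a" "a \<le> t" "0 \<le> s" "s \<le> t" for a s
      unfolding F_def G_def
    proof (rule has_derivative_compose[where g = f])
      show "((\<lambda>s. z + (a *\<^sub>R u + s *\<^sub>R v)) has_derivative (\<lambda>h. h *\<^sub>R v)) (at s)"
        by (auto intro!: derivative_eq_intros)
      show "(f has_derivative (\<lambda>h. gradient f (z + (a *\<^sub>R u + s *\<^sub>R v)) \<bullet> h))
          (at (z + (a *\<^sub>R u + s *\<^sub>R v)))"
        using df inU[OF that] by (blast intro: has_derivative_gradient)
    qed
    \<comment> \<open>The second difference is the increment of this function of \<open>s\<close>
      over [0, t]. The mean value theorem turns it into a difference of two gradients, both close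
      enough to \<open>z\<close> for the linearization \<open>dH\<close>.\<close>
    have "((\<lambda>s. F t s - F 0 s) has_derivative (\<lambda>h. G t s \<bullet> (h *\<^sub>R v) - G 0 s \<bullet> (h *\<^sub>R v)))
        (at s within {0..t})" if "0 \<le> s" "s \<le> t" for s
      using that t by (intro has_derivative_at_withinI[OF has_derivative_diff] dF) simp_all
    from mvt_simple[OF t(1) this] obtain s where s: "0 < s" "s < t" and
      mv: "F t t - F 0 t - F t 0 + F 0 0 = t * ((G t s - G 0 s) \<bullet> v)"
      by (auto simp: algebra_simps inner_diff_left)
    \<comment> \<open>Error of linearizing the gradient at \<open>z\<close>. In
      \<open>\<rho> t - \<rho> 0\<close> the contributions of \<open>s *\<^sub>R v\<close> cancel,
      so only \<open>t *\<^sub>R (H *v u)\<close> remains as main term.\<close>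
    define \<rho> where "\<rho> a = G a s - gradient f z - H *v (a *\<^sub>R u + s *\<^sub>R v)" for a
    have \<rho>: "norm (\<rho> a) \<le> \<epsilon> * (t * C)" if "0 \<le> a" "a \<le> t" for a
    proof -
      have n: "norm (a *\<^sub>R u + s *\<^sub>R v) \<le> t * C" using small that s by simp
      then have "norm (\<rho> a) \<le> \<epsilon> * norm (a *\<^sub>R u + s *\<^sub>R v)"
        using dH[of "z + (a *\<^sub>R u + s *\<^sub>R v)"] tC by (simp add: \<rho>_def G_def)
      also have "\<dots> \<le> \<epsilon> * (t * C)" using n \<epsilon> by (intro mult_left_mono) auto
      finally show ?thesis .
    qed
    have incr: "G t s - G 0 s = t *\<^sub>R (H *v u) + (\<rho> t - \<rho> 0)"
      by (simp add: \<rho>_def matrix_vector_right_distrib matrix_vector_mult_scaleR)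
    have "F t t - F 0 t - F t 0 + F 0 0 - t\<^sup>2 * (v \<bullet> (H *v u)) = t * ((\<rho> t - \<rho> 0) \<bullet> v)"
      unfolding mv incr by (simp add: inner_add_left inner_commute[of _ v] inner_add_right power2_eq_square distrib_left)
    also have "\<bar>\<dots>\<bar> \<le> t * ((2 * \<epsilon> * (t * C)) * C)"
    proof -
      have "norm (\<rho> t - \<rho> 0) \<le> 2 * \<epsilon> * (t * C)"
        using norm_triangle_ineq4[of "\<rho> t" "\<rho> 0"] \<rho>[of t] \<rho>[of 0] t by simp
      then have "\<bar>(\<rho> t - \<rho> 0) \<bullet> v\<bar> \<le> (2 * \<epsilon> * (t * C)) * C"
        using Cauchy_Schwarz_ineq2[of "\<rho> t - \<rho> 0" v] C \<epsilon> t
          mult_mono[of "norm (\<rho> t - \<rho> 0)" "2 * \<epsilon> * (t * C)" "norm v" C]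
        by fastforce
      then show ?thesis using t by (simp add: abs_mult)
    qed
    also have "\<dots> = e * t\<^sup>2" using C by (simp add: \<epsilon>_def power2_eq_square field_simps)
    finally show ?thesis by (simp add: F_def algebra_simps)
  qed
  then show ?thesis
    using \<delta> unfolding eventually_at_right_field H_def by blast
qed

lemma hessian_symmetric:
  fixes f :: "real^'n \<Rightarrow> real"
  assumes U: "open U" "z \<in> U" and df: "\<forall>x\<in>U. f differentiable (at x)"
    and ddf: "gradient f differentiable (at z)"
  shows "transpose (hessian f z) = hessian f z"
  unfolding transpose_eq_self_iff
proof (intro allI)
  note approx = second_difference_approx[OF assms]
  fix u v :: "real^'n"
  let ?a = "v \<bullet> (hessian f z *v u)" and ?b = "u \<bullet> (hessian f z *v v)"
  have "\<bar>?b - ?a\<bar> \<le> 0 + e" if "e > 0" for e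
  proof -
    have e: "e / 2 > 0" using that by simp
    \<comment> \<open>Swapping \<open>u\<close> and \<open>v\<close> leaves the second difference
      unchanged, so both quadratic terms lie within \<open>(e / 2) * t\<^sup>2\<close> of the same
      number. After division by \<open>t\<^sup>2\<close> the bound no longer depends on
      \<open>t\<close>.\<close>
    have "eventually (\<lambda>t. \<bar>?b - ?a\<bar> \<le> e) (at_right (0::real))"
      using approx[OF e, of u v] approx[OF e, of v u] eventually_at_right_less[of 0]
    proof eventually_elim
      case (elim t)
      have "t\<^sup>2 * \<bar>?b - ?a\<bar> = \<bar>t\<^sup>2 * ?b - t\<^sup>2 * ?a\<bar>"
        by (simp add: abs_mult flip: right_diff_distrib)
      also have "\<dots> \<le> t\<^sup>2 * e"
        using elim(1,2) add.commute[of "t *\<^sub>R u" "t *\<^sub>R v"] unfolding add.assoc[of z]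
        unfolding abs_le_iff by (simp add: mult.commute; linarith)
      finally show ?case using elim(3) by simp
    qed
    then show ?thesis by (simp add: eventually_const_iff)
  qed
  then have "\<bar>?b - ?a\<bar> \<le> 0" by (rule field_le_epsilon)
  then show "?b = ?a" by simp
qed

section \<open>Convexity\<close>

text \<open>Along a segment from \<open>x\<close> to \<open>y\<close> the second derivative of
  \<open>h\<close> is the quadratic form of its Hessian at \<open>y - x\<close>. As \<open>h\<close>
  is C2 on the open set \<open>U\<close> around \<open>S\<close>, two-sided derivatives exist at the
  endpoints too.\<close>

lemma convex_on_hessian_nonneg:
  fixes h :: "real^'n \<Rightarrow> real"
  assumes h: "C2_on h U" and S: "convex S" "S \<subseteq> U"
    and pos: "\<And>x v. x \<in> S \<Longrightarrow> 0 \<le> v \<bullet> (hessian h x *v v)"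
  shows "convex_on S h"
proof (rule convex_onI)
  fix t :: real and x y
  assume t: "0 < t" "t < 1" and xy: "x \<in> S" "y \<in> S"
  define \<gamma> where "\<gamma> s = x + s *\<^sub>R (y - x)" for s
  have \<gamma>S: "\<gamma> s \<in> S" if "s \<in> {0..1}" for s
  proof -
    have "\<gamma> s = (1 - s) *\<^sub>R x + s *\<^sub>R y" by (simp add: \<gamma>_def algebra_simps)
    then show ?thesis using convexD_alt[OF S(1) xy] that by simp
  qed
  have d\<gamma>: "(\<gamma> has_derivative (\<lambda>k. k *\<^sub>R (y - x))) (at s)" for s
    unfolding \<gamma>_def by (auto intro!: derivative_eq_intros)
  have "convex_on {0..1} (\<lambda>s. h (\<gamma> s))"
  proof (rule f''_ge0_imp_convex)
    fix s :: real assume s: "s \<in> {0..1}"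
    have U: "\<gamma> s \<in> U" using \<gamma>S[OF s] S by blast
    show "((\<lambda>s. h (\<gamma> s)) has_real_derivative (y - x) \<bullet> gradient h (\<gamma> s)) (at s)"
      using has_derivative_compose[OF d\<gamma> C2_onD(1)[OF h U]]
      by (simp add: has_field_derivative_def inner_commute mult_commute_abs)
    have "((\<lambda>s. gradient h (\<gamma> s)) has_derivative (\<lambda>k. hessian h (\<gamma> s) *v (k *\<^sub>R (y - x)))) (at s)"
      by (rule has_derivative_compose[OF d\<gamma> C2_onD(2)[OF h U]])
    from has_derivative_inner_right[OF this, of "y - x"]
    show "((\<lambda>s. (y - x) \<bullet> gradient h (\<gamma> s)) has_real_derivative
        (y - x) \<bullet> (hessian h (\<gamma> s) *v (y - x))) (at s)"
      by (simp add: has_field_derivative_def matrix_vector_mult_scaleR mult_commute_abs)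
    show "0 \<le> (y - x) \<bullet> (hessian h (\<gamma> s) *v (y - x))"
      by (rule pos[OF \<gamma>S[OF s]])
  qed simp
  from convex_onD[OF this, of t 0 1] t
  show "h ((1 - t) *\<^sub>R x + t *\<^sub>R y) \<le> (1 - t) * h x + t * h y"
    by (simp add: \<gamma>_def algebra_simps)
qed (fact S)

section \<open>Orthogonal projections and quadratic forms\<close>

text \<open>Since \<open>x - P x\<close> is orthogonal to the range of the projection
  \<open>P\<close>, the inner product of \<open>x\<close> and \<open>P y\<close> equals that of
  \<open>P x\<close> and \<open>P y\<close>, which is symmetric in \<open>x\<close> and
  \<open>y\<close> and nonnegative for \<open>x = y\<close>.\<close>

lemma
  fixes V :: "(real^'n) set"
  assumes V: "subspace V"
  shows psd_orth_proj: "psd (orth_proj V)"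
    and inner_orth_proj: "x \<bullet> (orth_proj V *v x) = (norm (orth_proj V *v x))\<^sup>2"
proof -
  let ?P = "orth_proj V"
  have *: "x \<bullet> (?P *v y) = (?P *v x) \<bullet> (?P *v y)" for x y
  proof -
    have "(?P *v y) \<bullet> (x - ?P *v x) = 0"
      using orth_proj_works[OF V] by (auto simp: orthogonal_comp_def orthogonal_def)
    then show ?thesis by (simp add: inner_diff_right inner_commute)
  qed
  show "x \<bullet> (?P *v x) = (norm (?P *v x))\<^sup>2" for x
    using *[of x x] by (simp add: dot_square_norm)
  show "psd ?P"
    unfolding psd_def transpose_eq_self_iff
    by (metis * inner_commute inner_ge_zero)
qed

lemma psd_scaleR: "psd A \<Longrightarrow> 0 \<le> c \<Longrightarrow> psd (c *\<^sub>R A)"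
  unfolding psd_def transpose_eq_self_iff
  by (simp add: scaleR_matrix_vector_assoc[symmetric])

lemma quadratic_form_add_le:
  fixes H :: "real^'n^'n"
  assumes sym: "transpose H = H" and R: "\<And>v. norm (H *v v) \<le> R * norm v" and "\<mu> > 0"
    and w: "w \<bullet> (H *v w) \<le> - \<mu> * (norm w)\<^sup>2"
  shows "(w + p) \<bullet> (H *v (w + p)) \<le> (R + R\<^sup>2 / \<mu>) * (norm p)\<^sup>2"
proof -
  have cs: "p \<bullet> (H *v v) \<le> norm p * (R * norm v)" for v
    using norm_cauchy_schwarz[of p "H *v v"] mult_left_mono[OF R[of v], of "norm p"] by simp
  have "(w + p) \<bullet> (H *v (w + p)) = w \<bullet> (H *v w) + 2 * (p \<bullet> (H *v w)) + p \<bullet> (H *v p)"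
    using sym[unfolded transpose_eq_self_iff]
    by (simp add: matrix_vector_right_distrib inner_add_left inner_add_right)
  also have "\<dots> \<le> - \<mu> * (norm w)\<^sup>2 + 2 * (norm p * (R * norm w)) + norm p * (R * norm p)"
    using w cs[of w] cs[of p] by linarith
  \<comment> \<open>Completing the square in \<open>norm w\<close>: absorbing the cross term into
    the negative term costs exactly \<open>R\<^sup>2 / \<mu>\<close> times
    \<open>(norm p)\<^sup>2\<close>.\<close>
  also have "\<dots> = (R + R\<^sup>2 / \<mu>) * (norm p)\<^sup>2 - (\<mu> * norm w - R * norm p)\<^sup>2 / \<mu>"
    using \<open>\<mu> > 0\<close> by (simp add: field_simps power2_eq_square)
  also have "\<dots> \<le> (R + R\<^sup>2 / \<mu>) * (norm p)\<^sup>2"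
    using \<open>\<mu> > 0\<close> by simp
  finally show ?thesis .
qed

lemma loewner_le_orth_proj:
  fixes H :: "real^'n^'n"
  assumes "transpose H = H" and "\<And>v. norm (H *v v) \<le> R * norm v" and "\<mu> > 0"
    and W: "subspace W" and neg: "\<And>w. w \<in> W \<Longrightarrow> w \<bullet> (H *v w) \<le> - \<mu> * (norm w)\<^sup>2"
  shows "loewner_le H ((R + R\<^sup>2 / \<mu>) *\<^sub>R orth_proj (W\<^sup>\<bottom>))"
proof -
  let ?P = "orth_proj (W\<^sup>\<bottom>)" and ?c = "R + R\<^sup>2 / \<mu>"
  note V = subspace_orthogonal_comp[of W]
  have "v \<bullet> (H *v v) \<le> ?c * (v \<bullet> (?P *v v))" for v
  proof -
    \<comment> \<open>The residual lies in the double orthogonal complement of \<open>W\<close>,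
      which is \<open>W\<close> itself, so the negativity hypothesis applies to it.\<close>
    have "v - ?P *v v \<in> W"
      using orth_proj_works(2)[OF V] by (simp add: orthogonal_comp_self[OF W])
    from quadratic_form_add_le[OF assms(1-3) neg[OF this], of "?P *v v"]
    show ?thesis by (simp add: inner_orth_proj[OF V])
  qed
  moreover have "transpose (?c *\<^sub>R ?P) = ?c *\<^sub>R ?P"
    using psd_orth_proj[OF V] unfolding psd_def transpose_eq_self_iff
    by (simp add: scaleR_matrix_vector_assoc[symmetric])
  ultimately show ?thesis
    using assms(1) unfolding loewner_le_def psd_def transpose_eq_self_iff
    by (simp add: matrix_vector_mult_diff_rdistrib inner_diff_right
        scaleR_matrix_vector_assoc[symmetric])
qed

section \<open>Bounds for the spectral norm\<close>

lemma norm_le_spectral_norm: "norm (A *v v) \<le> spectral_norm A * norm v"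
  unfolding spectral_norm_def by (rule onorm) simp

lemma spectral_norm_nonneg: "0 \<le> spectral_norm A"
  unfolding spectral_norm_def by (rule onorm_pos_le) simp

text \<open>The sum of the absolute values of the entries dominates the operator norm and is visibly
  continuous in \<open>z\<close>, hence bounded on the compact set.\<close>

lemma bdd_above_spectral_norm:
  fixes H :: "'a::topological_space \<Rightarrow> real^'n^'n"
  assumes "compact K" "continuous_on K H"
  shows "bdd_above ((\<lambda>z. spectral_norm (H z)) ` K)"
proof -
  have "compact ((\<lambda>z. \<Sum>i\<in>UNIV. \<Sum>j\<in>UNIV. \<bar>H z $ i $ j\<bar>) ` K)"
    using assms by (intro compact_continuous_image continuous_intros)
  then have "bdd_above ((\<lambda>z. \<Sum>i\<in>UNIV. \<Sum>j\<in>UNIV. \<bar>H z $ i $ j\<bar>) ` K)"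
    by (intro bounded_imp_bdd_above compact_imp_bounded)
  then obtain b where "\<And>z. z \<in> K \<Longrightarrow> (\<Sum>i\<in>UNIV. \<Sum>j\<in>UNIV. \<bar>H z $ i $ j\<bar>) \<le> b"
    unfolding bdd_above_def by blast
  then show ?thesis
    unfolding spectral_norm_def by (intro bdd_aboveI2) (rule order_trans[OF onorm_le_matrix_component_sum])
qed

text \<open>A majorant \<open>B\<close> yields a decomposition whose convex part \<open>g\<close> is
  the quadratic form of \<open>B\<close> halved. The other part, \<open>g - f\<close>, has Hessian
  \<open>B - hessian f x\<close>, which is positive semidefinite on the hull.\<close>

lemma d_star_le_dim:
  fixes f :: "real^'n \<Rightarrow> real" and B :: "real^'n^'n"
  assumes f: "C2_on f U" and XU: "convex hull X \<subseteq> U" and B: "B \<in> hess_majorants f X"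
    and V: "range (\<lambda>v. B *v v) \<subseteq> V"
  shows "d_star f X \<le> enat (dim V)"
proof -
  define g where "g = (\<lambda>x. (1/2) * (x \<bullet> (B *v x)))"
  have psdB: "psd B" using B by (simp add: hess_majorants_def)
  then have sym: "transpose B = B" by (simp add: psd_def)
  have gU: "C2_on g U"
    unfolding g_def using f by (intro C2_on_subset[OF C2_on_quadratic[OF sym]]) (auto simp: C2_on_def)
  have Hg: "hessian g = (\<lambda>x. B)" unfolding g_def by (rule hessian_quadratic[OF sym])
  let ?h = "\<lambda>x. g x - f x"
  have "convex_on (convex hull X) g"
    using psdB by (intro convex_on_hessian_nonneg[OF gU convex_convex_hull XU])
      (simp add: Hg psd_def)
  moreover have "convex_on (convex hull X) ?h"
  proof (rule convex_on_hessian_nonneg[OF C2_on_diff[OF gU f] convex_convex_hull XU])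
    fix x v assume x: "x \<in> convex hull X"
    then have "psd (B - hessian f x)"
      using B by (simp add: hess_majorants_def loewner_le_def)
    then show "0 \<le> v \<bullet> (hessian ?h x *v v)"
      using x XU by (subst hessian_diff[OF gU f]) (auto simp: Hg psd_def)
  qed
  moreover have "open U" using f by (simp add: C2_on_def)
  ultimately have "(g, ?h) \<in> D2 f X"
    using XU gU C2_on_diff[OF gU f] unfolding D2_def by auto
  then have "d_star f X \<le> enat (curv_dim X g)"
    unfolding d_star_def by (rule INF_lower2) simp
  \<comment> \<open>The Hessian of \<open>g\<close> is \<open>B\<close> at every point, so the
    curvature space is spanned by copies of the range of \<open>B\<close>.\<close>
  also have "curv_dim X g \<le> dim V"
    unfolding curv_dim_def curv_space_def dim_span Hg
    using V by (intro dim_subset) auto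
  finally show ?thesis by simp
qed

lemma dim_orthogonal_comp:
  fixes W :: "'a::euclidean_space set"
  assumes "subspace W"
  shows "dim (W\<^sup>\<bottom>) = DIM('a) - dim W"
  using dim_subspace_orthogonal_to_vectors[OF assms subspace_UNIV]
  by (simp add: orthogonal_comp_def)

theorem theorem5p2:
  fixes X U W V :: "(real^'n) set" and f :: "real^'n \<Rightarrow> real" and \<mu> R :: real
  assumes "compact X"
    and "affine hull X = UNIV"
    and "open U" and "convex hull X \<subseteq> U" and "C2_on f U"
    and "subspace W"
    and "\<mu> > 0"
    and "\<And>w z. w \<in> W \<Longrightarrow> z \<in> convex hull X \<Longrightarrow> w \<bullet> (hessian f z *v w) \<le> - \<mu> * (norm w)\<^sup>2"
    and "V = W\<^sup>\<bottom>"
    and "R = (SUP z\<in>convex hull X. spectral_norm (hessian f z))"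
  shows "bdd_above ((\<lambda>z. spectral_norm (hessian f z)) ` (convex hull X)) \<and>
    (R + R\<^sup>2 / \<mu>) *\<^sub>R orth_proj V \<in> hess_majorants f X \<and>
    d_star f X \<le> enat (CARD('n) - dim W)"
proof -
  note f = assms(5)
  let ?K = "convex hull X" and ?B = "(R + R\<^sup>2 / \<mu>) *\<^sub>R orth_proj V"
  have V: "subspace V" unfolding assms(9) by (rule subspace_orthogonal_comp)
  have "continuous_on ?K (hessian f)"
    using f assms(4) by (auto simp: C2_on_def intro: continuous_on_subset)
  then have bdd: "bdd_above ((\<lambda>z. spectral_norm (hessian f z)) ` ?K)"
    using \<open>compact X\<close> by (intro bdd_above_spectral_norm compact_convex_hull)
  have R: "spectral_norm (hessian f z) \<le> R" if "z \<in> ?K" for z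
    unfolding assms(10) using that bdd by (rule cSUP_upper)
  \<comment> \<open>The affine hull of the empty set is empty. A point of the hull is needed for
    \<open>0 \<le> R\<close>: one nonnegative spectral norm lies below the supremum.\<close>
  have "X \<noteq> {}" using assms(2) by auto
  then obtain z where "z \<in> ?K" using hull_subset[of X convex] by blast
  then have "0 \<le> R" using R spectral_norm_nonneg order_trans by blast
  then have "psd ?B"
    using \<open>\<mu> > 0\<close> by (intro psd_scaleR psd_orth_proj V) simp
  moreover have "loewner_le (hessian f z) ?B" if z: "z \<in> ?K" for z
    unfolding assms(9)
  proof (rule loewner_le_orth_proj[OF _ _ \<open>\<mu> > 0\<close> \<open>subspace W\<close> assms(8)[OF _ z]])
    show "transpose (hessian f z) = hessian f z"
      using f z assms(4) by (intro hessian_symmetric[of U]) (auto simp: C2_on_def)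
    show "norm (hessian f z *v v) \<le> R * norm v" for v
      using norm_le_spectral_norm[of "hessian f z" v] mult_right_mono[OF R[OF z], of "norm v"]
      by simp
  qed
  ultimately have B: "?B \<in> hess_majorants f X"
    by (simp add: hess_majorants_def)
  have "range (\<lambda>v. ?B *v v) \<subseteq> V"
    using orth_proj_works(1)[OF V] V
    by (auto simp: scaleR_matrix_vector_assoc[symmetric] intro: subspace_scale)
  then have "d_star f X \<le> enat (dim V)"
    by (rule d_star_le_dim[OF f assms(4) B])
  also have "dim V = CARD('n) - dim W"
    using dim_orthogonal_comp[OF \<open>subspace W\<close>] assms(9) by simp
  finally show ?thesis using bdd B by blast
qed

end
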